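(* Let $d\ge 2$. The maximum number $f_d(n)$ of $d$-simplices of unit $d$-volume formed by $n$ hyperplanes in $\mathbb{R}^d$ satisfies $$f_d(n)=\Omega_d(n^d),$$ that is, there is a constant $c_d>0$ depending only on $d$ such that $f_d(n)\ge c_d\,n^d$ for all $n\ge d+1$.
   Context: A set of $d+1$ hyperplanes in $\mathbb{R}^d$ forms a (non-degenerate) $d$-simplex if every $d$ of them meet in exactly one point and the $d+1$ hyperplanes have no common point; the $d$-simplex they form is the unique bounded cell of the arrangement of these $d+1$ hyperplanes (it may be cut by other hyperplanes of a larger arrangement). The $d$-simplices formed by a finite set $\mathcal{H}$ of distinct hyperplanes are the simplices formed by the $(d+1)$-element subsets of $\mathcal{H}$. The arrangement is not assumed to be in general position. The $d$-volume is the $d$-dimensional volume. $f_d(n)$ is the maximum, over all sets $\mathcal{H}$ of $n$ distinct hyperplanes in $\mathbb{R}^d$, of the number of $d$-simplices formed by $\mathcal{H}$ that have $d$-volume exactly $1$. *)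

theory Defs
  imports "HOL-Analysis.Analysis"
begin

definition hyperplane :: "(real ^ 'd) set \<Rightarrow> bool" where
  "hyperplane h \<longleftrightarrow> (\<exists>a b. a \<noteq> 0 \<and> h = {x. a \<bullet> x = b})"

definition forms_simplex :: "(real ^ 'd) set set \<Rightarrow> bool" where
  "forms_simplex S \<longleftrightarrow>
     card S = CARD('d) + 1 \<and> (\<forall>h\<in>S. hyperplane h) \<and>
     (\<forall>T\<subseteq>S. card T = CARD('d) \<longrightarrow> (\<exists>!x. x \<in> \<Inter>T)) \<and>
     \<Inter>S = {}"

text \<open>The cells of an arrangement are the connected components of the complement of its
  union.  They are open; passing to the closure does not change the volume.  The description
  below is meaningful only if \<open>forms_simplex S\<close> holds.\<close>

definition simplex_of :: "(real ^ 'd) set set \<Rightarrow> (real ^ 'd) set" where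
  "simplex_of S = (THE C. C \<in> components (- \<Union>S) \<and> bounded C)"

definition simplices_formed :: "(real ^ 'd) set set \<Rightarrow> (real ^ 'd) set set" where
  "simplices_formed H = {simplex_of S | S. S \<subseteq> H \<and> forms_simplex S}"

definition unit_simplices :: "(real ^ 'd) set set \<Rightarrow> (real ^ 'd) set set" where
  "unit_simplices H = {C \<in> simplices_formed H. measure lborel C = 1}"

text \<open>The type argument carries the dimension \<open>d = CARD('d)\<close>.  The maximum is over a set of
  numbers that is nonempty for \<open>d \<ge> 1\<close> and bounded by \<open>n choose (d + 1)\<close>.\<close>

definition max_unit_simplices :: "'d::finite itself \<Rightarrow> nat \<Rightarrow> nat" where
  "max_unit_simplices _ n =
     Max {card (unit_simplices H) | H :: (real ^ 'd) set set.
            finite H \<and> card H = n \<and> (\<forall>h\<in>H. hyperplane h)}"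

end

theory Submission
  imports Defs
begin

text \<open>
  Let \<open>d\<close> be the dimension and let \<open>s\<close> be the \<open>d\<close>-th root of \<open>d!\<close>.  A right-angled corner
  simplex, cut off at a point \<open>a\<close> by the \<open>d\<close> axis-parallel hyperplanes \<open>x\<^sub>i = a\<^sub>i\<close> and the
  diagonal hyperplane \<open>\<Sum>x\<^sub>i = \<Sum>a\<^sub>i + s\<close>, has volume \<open>s\<^sup>d / d! = 1\<close>.  When \<open>a\<close> runs over the grid
  \<open>s k\<close> with \<open>k \<in> {0..N-1}\<^sup>d\<close>, this produces \<open>N\<^sup>d\<close> different unit simplices, but only few
  hyperplanes: \<open>d N\<close> axis-parallel ones, and, because \<open>\<Sum>k\<^sub>i + 1\<close> is an integer between
  \<open>1\<close> and \<open>d (N - 1) + 1\<close>, at most \<open>d (N - 1) + 1\<close> diagonal ones.  So \<open>N\<^sup>d\<close> unit simplices cost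
  at most \<open>2 d N - d + 1\<close> hyperplanes, and further hyperplanes never destroy a simplex.  The
  largest admissible \<open>N\<close> for \<open>n \<ge> d + 1\<close> is positive and at least \<open>n / (4 d)\<close>.

  Most of the work is to identify the abstractly defined cell of the \<open>d + 1\<close> hyperplanes with
  the open corner simplex (\<open>simplex_of_corner_planes\<close>).  The corner is a component of the
  complement because its frontier lies in the hyperplanes, and it is the only bounded
  component because every other point of the complement escapes to infinity along a coordinate
  direction without meeting a hyperplane (\<open>escaping_ray\<close>).  The volume comes from the standard
  simplex by an affine map (\<open>measure_open_corner\<close>), and the count is done in
  \<open>grid_unit_simplices\<close>.
\<close>

section \<open>The hyperplanes of a corner simplex\<close>

definition coord_plane :: "'d::finite \<Rightarrow> real \<Rightarrow> (real ^ 'd) set" where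
  "coord_plane i c = {x. x $ i = c}"

definition diag_plane :: "real \<Rightarrow> (real ^ 'd::finite) set" where
  "diag_plane c = {x. (\<Sum>i\<in>UNIV. x $ i) = c}"

definition corner_planes :: "real ^ 'd::finite \<Rightarrow> real \<Rightarrow> (real ^ 'd) set set" where
  "corner_planes a s =
     insert (diag_plane ((\<Sum>i\<in>UNIV. a $ i) + s)) (range (\<lambda>i. coord_plane i (a $ i)))"

definition open_corner :: "real ^ 'd::finite \<Rightarrow> real \<Rightarrow> (real ^ 'd) set" where
  "open_corner a s = {x. (\<forall>i. a $ i < x $ i) \<and> (\<Sum>i\<in>UNIV. x $ i) < (\<Sum>i\<in>UNIV. a $ i) + s}"

lemma hyperplane_coord_plane: "hyperplane (coord_plane i c)"
  unfolding hyperplane_def coord_plane_def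
  by (rule exI[of _ "axis i 1"], rule exI[of _ c])
     (auto simp: inner_axis' axis_eq_0_iff)

lemma hyperplane_diag_plane: "hyperplane (diag_plane c)"
  unfolding hyperplane_def diag_plane_def
  by (rule exI[of _ 1], rule exI[of _ c]) (auto simp: inner_vec_def)

lemma sum_add_axis:
  fixes a :: "real ^ 'd::finite"
  shows "(\<Sum>i\<in>UNIV. (a + t *\<^sub>R axis k 1) $ i) = (\<Sum>i\<in>UNIV. a $ i) + t"
proof -
  have "(\<Sum>i\<in>UNIV. (a + t *\<^sub>R axis k 1) $ i) = (\<Sum>i\<in>UNIV. a $ i + (if i = k then t else 0))"
    by (rule sum.cong) (auto simp: axis_def)
  then show ?thesis
    by (simp add: sum.distrib)
qed

text \<open>The point used in the proof lies on \<open>x\<^sub>i = c\<close> but avoids \<open>x\<^sub>j = e\<close> for every \<open>j \<noteq> i\<close>.\<close>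

lemma coord_plane_eq_iff: "coord_plane i c = coord_plane j e \<longleftrightarrow> i = j \<and> c = e"
proof
  assume eq: "coord_plane i c = coord_plane j e"
  have "(\<chi> k. if k = i then c else e + 1) \<in> coord_plane i c"
    by (simp add: coord_plane_def)
  then have "(\<chi> k. if k = i then c else e + 1) \<in> coord_plane j e"
    using eq by simp
  then show "i = j \<and> c = e"
    by (auto simp: coord_plane_def split: if_splits)
qed auto

lemma diag_plane_notin_coord_planes:
  fixes a :: "real ^ 'd::finite"
  assumes "s \<noteq> 0"
  shows "diag_plane ((\<Sum>i\<in>UNIV. a $ i) + s) \<notin> range (\<lambda>i. coord_plane i (a $ i))"
proof -
  have "a \<in> coord_plane i (a $ i)" "a \<notin> diag_plane ((\<Sum>i\<in>UNIV. a $ i) + s)" for i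
    using assms by (auto simp: coord_plane_def diag_plane_def)
  then show ?thesis
    by (metis imageE)
qed

lemma card_corner_planes:
  fixes a :: "real ^ 'd::finite"
  assumes "s \<noteq> 0"
  shows "card (corner_planes a s) = CARD('d) + 1"
proof -
  have "inj (\<lambda>i. coord_plane i (a $ i))"
    by (auto simp: inj_def coord_plane_eq_iff)
  then show ?thesis
    using diag_plane_notin_coord_planes[OF assms, of a]
    by (simp add: corner_planes_def card_image)
qed

text \<open>Any \<open>d\<close> of the planes omit exactly one.  If it is the diagonal plane, the others meet in the
  apex \<open>a\<close>; if it is the \<open>k\<close>-th coordinate plane, the others fix all coordinates but the
  \<open>k\<close>-th, and the diagonal plane then fixes that one, giving \<open>a + s e\<^sub>k\<close>.\<close>

lemma forms_simplex_corner_planes: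
  fixes a :: "real ^ 'd::finite"
  assumes s: "s \<noteq> 0"
  shows "forms_simplex (corner_planes a s)"
  unfolding forms_simplex_def
proof (intro conjI ballI allI impI)
  let ?D = "diag_plane ((\<Sum>i\<in>UNIV. a $ i) + s)" and ?P = "\<lambda>i. coord_plane i (a $ i)"
  let ?S = "corner_planes a s"
  show card_S: "card ?S = CARD('d) + 1"
    using s by (rule card_corner_planes)
  show "hyperplane h" if "h \<in> ?S" for h
    using that by (auto simp: corner_planes_def hyperplane_coord_plane hyperplane_diag_plane)
  have apex: "x \<in> \<Inter>(range ?P) \<longleftrightarrow> x = a" for x
    by (auto simp: coord_plane_def vec_eq_iff)
  have a_notin: "a \<notin> ?D"
    using s by (simp add: diag_plane_def)
  show "\<Inter>?S = {}"
    using apex a_notin by (auto simp: corner_planes_def)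
  fix T assume T: "T \<subseteq> ?S" "card T = CARD('d)"
  have "finite ?S"
    by (simp add: corner_planes_def)
  then have "card (?S - T) = 1"
    using T card_S by (simp add: card_Diff_subset finite_subset)
  then obtain h where "?S - T = {h}"
    by (auto simp: card_1_singleton_iff)
  then have h: "h \<in> ?S" "T = ?S - {h}"
    using T by auto
  show "\<exists>!x. x \<in> \<Inter>T"
  proof (cases "h = ?D")
    case True
    then have "T = range ?P"
      using h diag_plane_notin_coord_planes[OF s, of a] by (auto simp: corner_planes_def)
    then show ?thesis
      using apex by auto
  next
    case False
    then obtain k where k: "h = ?P k"
      using h by (auto simp: corner_planes_def)
    have T_eq: "T = insert ?D (?P ` (- {k}))"
      using h k False by (auto simp: corner_planes_def coord_plane_eq_iff)
    have mem: "x \<in> \<Inter>T \<longleftrightarrow> (\<forall>i. i \<noteq> k \<longrightarrow> x $ i = a $ i) \<and> (\<Sum>i\<in>UNIV. x $ i) = (\<Sum>i\<in>UNIV. a $ i) + s"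
      for x
      unfolding T_eq by (auto simp: coord_plane_def diag_plane_def)
    show ?thesis
    proof (rule ex1I[of _ "a + s *\<^sub>R axis k 1"])
      show "a + s *\<^sub>R axis k 1 \<in> \<Inter>T"
        unfolding mem sum_add_axis by (auto simp: axis_def)
    next
      fix x assume "x \<in> \<Inter>T"
      then have x: "\<And>i. i \<noteq> k \<Longrightarrow> x $ i = a $ i" "(\<Sum>i\<in>UNIV. x $ i) = (\<Sum>i\<in>UNIV. a $ i) + s"
        unfolding mem by auto
      then have "x = a + (x $ k - a $ k) *\<^sub>R axis k 1"
        by (auto simp: vec_eq_iff axis_def)
      moreover from this have "x $ k - a $ k = s"
        using x(2) sum_add_axis[of a "x $ k - a $ k" k] by simp
      ultimately show "x = a + s *\<^sub>R axis k 1"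
        by simp
    qed
  qed
qed

section \<open>Shape and volume of the corner\<close>

text \<open>Convexity, boundedness, nonemptiness and volume of the corner are all inherited from the
  standard simplex through this affine map.\<close>

lemma open_corner_eq_image:
  fixes a :: "real ^ 'd::finite"
  assumes s: "s > 0"
  shows "open_corner a s = (\<lambda>x. s *\<^sub>R x + a) ` interior (convex hull (insert 0 Basis))"
proof -
  have std: "interior (convex hull (insert 0 Basis)) =
      {x :: real ^ 'd. (\<forall>i. 0 < x $ i) \<and> (\<Sum>i\<in>UNIV. x $ i) < 1}"
  proof -
    have B: "(Basis :: (real ^ 'd) set) = range (\<lambda>i. axis i 1)"
      by (auto simp: Basis_vec_def)
    have inj: "inj (\<lambda>i::'d. axis i (1::real))"
      by (auto simp: inj_def axis_eq_axis)
    show ?thesis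
      unfolding interior_std_simplex unfolding B sum.reindex[OF inj] by (simp add: inner_axis)
  qed
  have "x \<in> open_corner a s \<longleftrightarrow>
      (1 / s) *\<^sub>R (x - a) \<in> {x. (\<forall>i. 0 < x $ i) \<and> (\<Sum>i\<in>UNIV. x $ i) < 1}" for x
    using s by (simp add: open_corner_def sum_subtractf flip: sum_divide_distrib) (simp add: field_simps)
  moreover have "x \<in> (\<lambda>x. s *\<^sub>R x + a) ` K \<longleftrightarrow> (1 / s) *\<^sub>R (x - a) \<in> K" for x K
    using s by (auto intro: image_eqI[of _ _ "(1 / s) *\<^sub>R (x - a)"])
  ultimately show ?thesis
    unfolding std by (intro set_eqI) (simp only:)
qed

lemma open_open_corner: "open (open_corner a s)"
  unfolding open_corner_def
  by (simp add: Collect_conj_eq Collect_all_eq)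
     (auto intro!: open_Int open_INT open_Collect_less continuous_intros)

lemma measure_open_corner:
  fixes a :: "real ^ 'd::finite"
  assumes s: "s > 0"
  shows "measure lborel (open_corner a s) = s ^ CARD('d) / fact CARD('d)"
proof -
  let ?K = "convex hull (insert 0 Basis) :: (real ^ 'd) set"
  have K: "bounded ?K" "convex ?K" "compact ?K"
    by (auto intro!: finite_imp_bounded_convex_hull finite_imp_compact_convex_hull)
  have "open_corner a s \<in> sets lborel"
    by (simp add: borel_open open_open_corner)
  then have "measure lborel (open_corner a s) = measure lebesgue (open_corner a s)"
    by simp
  also have "\<dots> = \<bar>s\<bar> ^ DIM(real ^ 'd) * measure lebesgue (interior ?K)"
    unfolding open_corner_eq_image[OF s] by (rule measure_lebesgue_affine)
  also have "measure lebesgue (interior ?K) = measure lebesgue ?K"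
    using K by (intro measure_interior negligible_convex_frontier)
  also have "\<dots> = measure lborel ?K"
    using K by (simp add: borel_compact)
  also have "\<dots> = 1 / fact DIM(real ^ 'd)"
    by (rule content_std_simplex)
  finally show ?thesis
    using s by simp
qed

lemma frontier_open_corner: "frontier (open_corner a s) \<subseteq> \<Union>(corner_planes a s)"
proof
  fix x assume x: "x \<in> frontier (open_corner a s)"
  let ?K = "{x. (\<forall>i. a $ i \<le> x $ i) \<and> (\<Sum>i\<in>UNIV. x $ i) \<le> (\<Sum>i\<in>UNIV. a $ i) + s}"
  have "closed ?K"
    by (simp add: Collect_conj_eq Collect_all_eq)
       (auto intro!: closed_Int closed_INT closed_Collect_le continuous_intros)
  moreover have "open_corner a s \<subseteq> ?K"
    by (auto simp: open_corner_def less_imp_le)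
  ultimately have "closure (open_corner a s) \<subseteq> ?K"
    by (rule closure_minimal[rotated])
  moreover have "x \<in> closure (open_corner a s)" "x \<notin> open_corner a s"
    using x open_open_corner[of a s] by (auto simp: frontier_def interior_open)
  ultimately have K: "\<And>i. a $ i \<le> x $ i" "(\<Sum>i\<in>UNIV. x $ i) \<le> (\<Sum>i\<in>UNIV. a $ i) + s"
    and "x \<notin> open_corner a s"
    by auto
  then consider i where "x $ i \<le> a $ i" | "(\<Sum>i\<in>UNIV. x $ i) \<ge> (\<Sum>i\<in>UNIV. a $ i) + s"
    by (auto simp: open_corner_def not_less)
  then show "x \<in> \<Union>(corner_planes a s)"
  proof cases
    case (1 i)
    then have "x \<in> coord_plane i (a $ i)"
      using K(1)[of i] by (simp add: coord_plane_def)
    then show ?thesis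
      by (auto simp: corner_planes_def)
  next
    case 2
    then have "x \<in> diag_plane ((\<Sum>i\<in>UNIV. a $ i) + s)"
      using K(2) by (simp add: diag_plane_def)
    then show ?thesis
      by (auto simp: corner_planes_def)
  qed
qed

lemma not_in_corner_planes_iff:
  "x \<notin> \<Union>(corner_planes a s) \<longleftrightarrow>
     (\<forall>i. x $ i \<noteq> a $ i) \<and> (\<Sum>i\<in>UNIV. x $ i) \<noteq> (\<Sum>i\<in>UNIV. a $ i) + s"
  by (auto simp: corner_planes_def coord_plane_def diag_plane_def)

section \<open>The corner is the bounded cell\<close>

text \<open>Beyond the diagonal plane some coordinate of \<open>y\<close> exceeds that of \<open>a\<close>; increasing it
  increases the coordinate sum too, so neither a coordinate plane nor the diagonal plane is
  met.  Before the diagonal plane, a point outside the corner has some coordinate below that of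
  \<open>a\<close>, and decreasing it is equally safe.\<close>

lemma escaping_ray:
  fixes a y :: "real ^ 'd::finite"
  assumes s: "s > 0" and y: "y \<notin> \<Union>(corner_planes a s)" "y \<notin> open_corner a s"
  obtains u where "norm u = 1" "\<And>t. t \<ge> 0 \<Longrightarrow> y + t *\<^sub>R u \<notin> \<Union>(corner_planes a s)"
proof -
  have ne: "\<And>i. y $ i \<noteq> a $ i" "(\<Sum>i\<in>UNIV. y $ i) \<noteq> (\<Sum>i\<in>UNIV. a $ i) + s"
    using y(1) unfolding not_in_corner_planes_iff by auto
  show ?thesis
  proof (cases "(\<Sum>i\<in>UNIV. y $ i) > (\<Sum>i\<in>UNIV. a $ i) + s")
    case True
    have "\<exists>k. y $ k > a $ k"
    proof (rule ccontr)
      assume "\<not> ?thesis"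
      then have "(\<Sum>i\<in>UNIV. y $ i) \<le> (\<Sum>i\<in>UNIV. a $ i)"
        by (auto intro!: sum_mono simp: not_less)
      then show False
        using True s by simp
    qed
    then obtain k where k: "y $ k > a $ k" ..
    show ?thesis
    proof (rule that)
      show "y + t *\<^sub>R axis k 1 \<notin> \<Union>(corner_planes a s)" if "t \<ge> 0" for t
        using that True ne(1) k unfolding not_in_corner_planes_iff sum_add_axis
        by (auto simp: axis_def)
    qed simp
  next
    case False
    then have less: "(\<Sum>i\<in>UNIV. y $ i) < (\<Sum>i\<in>UNIV. a $ i) + s"
      using ne by simp
    then obtain k where k: "y $ k < a $ k"
      using y(2) ne(1) by (auto simp: open_corner_def not_less order_le_less)
    show ?thesis
    proof (rule that)
      have eq: "y + t *\<^sub>R - axis k 1 = y + (- t) *\<^sub>R axis k 1" for t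
        by simp
      show "y + t *\<^sub>R - axis k 1 \<notin> \<Union>(corner_planes a s)" if "t \<ge> 0" for t
        using that less ne(1) k unfolding not_in_corner_planes_iff eq sum_add_axis
        by (auto simp: axis_def)
    qed simp
  qed
qed

lemma simplex_of_corner_planes:
  fixes a :: "real ^ 'd::finite"
  assumes s: "s > 0"
  shows "simplex_of (corner_planes a s) = open_corner a s"
  unfolding simplex_of_def
proof (rule the_equality)
  let ?C = "open_corner a s" and ?U = "\<Union>(corner_planes a s)"
  let ?K = "interior (convex hull (insert 0 Basis)) :: (real ^ 'd) set"
  have "convex ?C" "bounded ?C" "?C \<noteq> {}"
  proof -
    have "bounded ?K"
      by (intro bounded_interior finite_imp_bounded_convex_hull) simp
    then show "bounded ?C"
      unfolding open_corner_eq_image[OF s] image_image[of "\<lambda>x. x + a" "(*\<^sub>R) s", symmetric]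
      by (metis bounded_scaling bounded_translation add.commute image_cong)
    have "convex ?K"
      by (intro convex_interior convex_convex_hull)
    then show "convex ?C"
      unfolding open_corner_eq_image[OF s] add.commute[of _ a] by (rule convex_affinity)
    show "?C \<noteq> {}"
      unfolding open_corner_eq_image[OF s] using interior_std_simplex_nonempty by blast
  qed
  note C = this
  have "?C \<subseteq> - ?U"
  proof
    fix x assume "x \<in> ?C"
    then have "\<And>i. a $ i < x $ i" "(\<Sum>i\<in>UNIV. x $ i) < (\<Sum>i\<in>UNIV. a $ i) + s"
      by (auto simp: open_corner_def)
    then have "x \<notin> ?U"
      unfolding not_in_corner_planes_iff by (metis less_irrefl)
    then show "x \<in> - ?U"
      by simp
  qed
  moreover have "D = ?C" if D: "?C \<subseteq> D" "D \<subseteq> - ?U" "connected D" for D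
  proof (rule ccontr)
    assume "D \<noteq> ?C"
    then have "D \<inter> frontier ?C \<noteq> {}"
      using C D by (intro connected_Int_frontier) auto
    then show False
      using frontier_open_corner[of a s] D by blast
  qed
  ultimately have comp: "?C \<in> components (- ?U)"
    using C convex_connected by (auto simp: in_components_maximal)
  then show "?C \<in> components (- ?U) \<and> bounded ?C"
    using C by simp
  fix C' assume C': "C' \<in> components (- ?U) \<and> bounded C'"
  show "C' = ?C"
  proof (rule ccontr)
    assume "C' \<noteq> ?C"
    then have disj: "C' \<inter> ?C = {}"
      using C' comp components_eq by blast
    obtain y where y: "y \<in> C'"
      using C' in_components_nonempty by fastforce
    then have "y \<notin> ?U" "y \<notin> ?C"
      using C' disj in_components_subset by blast+
    then obtain u where u: "norm u = 1" "\<And>t. t \<ge> 0 \<Longrightarrow> y + t *\<^sub>R u \<notin> ?U"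
      using escaping_ray[OF s] by blast
    let ?R = "(\<lambda>t. y + t *\<^sub>R u) ` {0..}"
    have "connected ?R"
      by (intro connected_continuous_image continuous_intros) simp
    moreover have "y \<in> ?R"
      by (rule image_eqI[of _ _ 0]) auto
    ultimately have R: "?R \<subseteq> C'"
      using C' y u(2) by (intro components_maximal[of C' "- ?U"]) auto
    obtain B where B: "\<And>x. x \<in> C' \<Longrightarrow> norm x \<le> B"
      using C' by (auto simp: bounded_iff)
    \<comment> \<open>far enough along the ray to leave the ball of radius \<open>B\<close>, wherever it starts\<close>
    define t where "t = B + norm y + 1"
    have "norm y \<le> B"
      using B y by blast
    then have "t \<ge> 0"
      unfolding t_def using norm_ge_zero[of y] by linarith
    then have "norm (y + t *\<^sub>R u) \<le> B"
      using R B by auto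
    moreover have "norm (y + t *\<^sub>R u) \<ge> t - norm y"
      using norm_diff_ineq[of "t *\<^sub>R u" y] u(1) \<open>t \<ge> 0\<close> by (simp add: add.commute)
    ultimately show False
      by (simp add: t_def)
  qed
qed

section \<open>Counting\<close>

text \<open>The apex is the coordinatewise infimum of its corner, since the corner contains the points
  \<open>a + \<epsilon> (1, \<dots>, 1)\<close> for all small \<open>\<epsilon>\<close>.  Hence distinct apices give distinct corners.\<close>

lemma open_corner_subset_imp_le:
  fixes a b :: "real ^ 'd::finite"
  assumes s: "s > 0" and sub: "open_corner a s \<subseteq> open_corner b r"
  shows "b $ i \<le> a $ i"
proof (rule field_le_epsilon)
  fix e :: real assume "e > 0"
  \<comment> \<open>the denominator \<open>d + 1\<close> keeps the coordinate sum strictly below the diagonal plane\<close>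
  define \<epsilon> where "\<epsilon> = min e (s / (CARD('d) + 1))"
  have \<epsilon>: "\<epsilon> > 0" "\<epsilon> \<le> e"
    using \<open>e > 0\<close> s by (auto simp: \<epsilon>_def)
  have "CARD('d) * \<epsilon> \<le> CARD('d) * (s / (CARD('d) + 1))"
    by (intro mult_left_mono) (auto simp: \<epsilon>_def)
  also have "\<dots> < s"
    using s by (simp add: field_simps)
  finally have "(\<chi> j. a $ j + \<epsilon>) \<in> open_corner a s"
    using \<epsilon> by (simp add: open_corner_def sum.distrib)
  then have "(\<chi> j. a $ j + \<epsilon>) \<in> open_corner b r"
    using sub by blast
  then have "b $ i < a $ i + \<epsilon>"
    by (simp add: open_corner_def)
  then show "b $ i \<le> a $ i + e"
    using \<epsilon> by simp
qed

lemma open_corner_eq_iff: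
  assumes "s > 0"
  shows "open_corner a s = open_corner b s \<longleftrightarrow> a = b"
proof
  assume eq: "open_corner a s = open_corner b s"
  have "a $ i = b $ i" for i
    using open_corner_subset_imp_le[OF assms, of a b s i]
      open_corner_subset_imp_le[OF assms, of b a s i] eq by simp
  then show "a = b"
    by (simp add: vec_eq_iff)
qed simp

lemma open_corner_in_unit_simplices:
  fixes a :: "real ^ 'd::finite"
  assumes "s > 0" "s ^ CARD('d) = fact CARD('d)" "corner_planes a s \<subseteq> H"
  shows "open_corner a s \<in> unit_simplices H"
  unfolding unit_simplices_def simplices_formed_def
proof (intro CollectI conjI exI)
  show "open_corner a s = simplex_of (corner_planes a s)"
    using assms(1) by (simp add: simplex_of_corner_planes)
  show "forms_simplex (corner_planes a s)"
    using assms(1) by (intro forms_simplex_corner_planes) simp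
  show "measure lborel (open_corner a s) = 1"
    using assms(1,2) by (simp add: measure_open_corner)
qed (fact assms(3))

text \<open>The bound in terms of \<open>card H\<close> alone makes the set of numbers whose maximum is taken
  finite; without it \<open>Max\<close> would say nothing.\<close>

lemma finite_unit_simplices:
  assumes "finite H"
  shows "finite (unit_simplices H)" "card (unit_simplices H) \<le> 2 ^ card H"
proof -
  have sub: "unit_simplices H \<subseteq> simplex_of ` Pow H"
    by (auto simp: unit_simplices_def simplices_formed_def)
  show "finite (unit_simplices H)"
    using sub assms by (meson finite_Pow_iff finite_imageI finite_subset)
  have "card (unit_simplices H) \<le> card (simplex_of ` Pow H)"
    using sub assms by (intro card_mono) auto
  also have "\<dots> \<le> card (Pow H)"
    using assms by (intro card_image_le) auto
  finally show "card (unit_simplices H) \<le> 2 ^ card H"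
    using assms by (simp add: card_Pow)
qed

text \<open>A set of fewer than \<open>n\<close> hyperplanes can be padded with parallel coordinate planes: a simplex
  depends only on its own \<open>d + 1\<close> hyperplanes, so the added ones destroy none.\<close>

lemma card_unit_simplices_le_max:
  fixes H :: "(real ^ 'd::finite) set set"
  assumes H: "finite H" "card H \<le> n" "\<forall>h\<in>H. hyperplane h"
  shows "card (unit_simplices H) \<le> max_unit_simplices TYPE('d) n"
proof -
  let ?F = "{card (unit_simplices H) | H :: (real ^ 'd) set set.
            finite H \<and> card H = n \<and> (\<forall>h\<in>H. hyperplane h)}"
  have "inj (coord_plane (undefined :: 'd))"
    by (auto simp: inj_def coord_plane_eq_iff)
  then have "infinite (range (coord_plane (undefined :: 'd)))"
    by (simp add: finite_image_iff infinite_UNIV_char_0)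
  then have "infinite (range (coord_plane (undefined :: 'd)) - H)"
    using H by simp
  then obtain E where E: "finite E" "card E = n - card H"
      "E \<subseteq> range (coord_plane (undefined :: 'd)) - H"
    using infinite_arbitrarily_large by blast
  have "card (H \<union> E) = n"
    using E H by (subst card_Un_disjoint) auto
  moreover have "\<forall>h\<in>H \<union> E. hyperplane h"
    using E H hyperplane_coord_plane by blast
  ultimately have mem: "card (unit_simplices (H \<union> E)) \<in> ?F"
    using E H by blast
  have "finite ?F"
    by (rule finite_subset[of _ "{..2 ^ n}"]) (auto dest: finite_unit_simplices(2))
  have "card (unit_simplices H) \<le> card (unit_simplices (H \<union> E))"
    using E H by (intro card_mono finite_unit_simplices)
      (auto simp: unit_simplices_def simplices_formed_def)
  also have "\<dots> \<le> Max ?F"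
    using \<open>finite ?F\<close> mem by (rule Max_ge)
  finally show ?thesis
    by (simp add: max_unit_simplices_def)
qed

text \<open>The corner with apex \<open>s k\<close>, for \<open>k \<in> {0..N-1}\<^sup>d\<close>, has its diagonal plane at level
  \<open>s (\<Sum>k\<^sub>i + 1)\<close>, which is again an integer multiple of \<open>s\<close>.  This is why \<open>N\<^sup>d\<close> corners can
  share linearly many diagonal planes.\<close>

lemma grid_unit_simplices:
  assumes N: "N \<ge> 1" and n: "CARD('d::finite) * N + (CARD('d) * (N - 1) + 1) \<le> n"
  shows "N ^ CARD('d) \<le> max_unit_simplices TYPE('d) n"
proof -
  define s where "s = root CARD('d) (fact CARD('d))"
  have s: "s > 0" "s ^ CARD('d) = fact CARD('d)"
    by (auto simp: s_def)
  let ?A = "(\<lambda>(i::'d, k). coord_plane i (s * real k)) ` (UNIV \<times> {..<N})"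
  let ?B = "(\<lambda>m. diag_plane (s * real m) :: (real ^ 'd) set) ` {1..CARD('d) * (N - 1) + 1}"
  let ?H = "?A \<union> ?B"
  let ?G = "UNIV \<rightarrow>\<^sub>E {..<N} :: ('d \<Rightarrow> nat) set"
  let ?v = "\<lambda>k. (\<chi> i. s * real (k i)) :: real ^ 'd"
  have "card ?H \<le> n"
  proof -
    have "card ?A \<le> card ((UNIV :: 'd set) \<times> {..<N})" "card ?B \<le> card {1..CARD('d) * (N - 1) + 1}"
      by (rule card_image_le, simp)+
    then show ?thesis
      using card_Un_le[of ?A ?B] n by simp
  qed
  moreover have "\<forall>h\<in>?H. hyperplane h"
    by (auto simp: hyperplane_coord_plane hyperplane_diag_plane)
  ultimately have le: "card (unit_simplices ?H) \<le> max_unit_simplices TYPE('d) n"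
    by (intro card_unit_simplices_le_max) auto
  have planes: "corner_planes (?v k) s \<subseteq> ?H" if k: "k \<in> ?G" for k
  proof -
    have "coord_plane i (?v k $ i) \<in> ?A" for i
      using k by (auto simp: PiE_iff intro!: image_eqI[of _ _ "(i, k i)"])
    moreover have "diag_plane ((\<Sum>i\<in>UNIV. ?v k $ i) + s) \<in> ?B"
    proof (rule image_eqI[of _ _ "(\<Sum>i\<in>UNIV. k i) + 1"])
      have "k i \<le> N - 1" for i
        using k N by (auto simp: PiE_iff dest!: spec[of _ i])
      then have "(\<Sum>i\<in>UNIV. k i) \<le> CARD('d) * (N - 1)"
        using sum_bounded_above[of UNIV k "N - 1"] by simp
      then show "(\<Sum>i\<in>UNIV. k i) + 1 \<in> {1..CARD('d) * (N - 1) + 1}"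
        by simp
    qed (simp add: sum_distrib_left algebra_simps)
    ultimately show ?thesis
      by (auto simp: corner_planes_def)
  qed
  have "inj_on (\<lambda>k. open_corner (?v k) s) ?G"
    using s by (auto simp: inj_on_def open_corner_eq_iff vec_eq_iff)
  moreover have "(\<lambda>k. open_corner (?v k) s) ` ?G \<subseteq> unit_simplices ?H"
    using s planes by (blast intro: open_corner_in_unit_simplices)
  moreover have "finite (unit_simplices ?H)"
    by (intro finite_unit_simplices) simp
  ultimately have "card ?G \<le> card (unit_simplices ?H)"
    by (rule card_inj_on_le)
  then show ?thesis
    using le by (simp add: card_PiE)
qed

theorem theorem1p2:
  assumes "CARD('d::finite) \<ge> 2"
  shows "\<exists>c::real. c > 0 \<and>
           (\<forall>n \<ge> CARD('d) + 1. real (max_unit_simplices TYPE('d) n) \<ge> c * real n ^ CARD('d))"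
proof (intro exI[of _ "(1 / (4 * real CARD('d))) ^ CARD('d)"] conjI allI impI)
  let ?d = "CARD('d)"
  show "(1 / (4 * real ?d)) ^ ?d > 0"
    by simp
  fix n assume n: "n \<ge> ?d + 1"
  \<comment> \<open>the largest grid whose \<open>2 d N - d + 1\<close> hyperplanes are affordable; \<open>N = 1\<close> at \<open>n = d + 1\<close>\<close>
  define N where "N = (n + ?d - 1) div (2 * ?d)"
  have "?d > 0"
    by simp
  then have N: "N \<ge> 1"
    using n by (simp add: N_def Suc_le_eq div_greater_zero_iff)
  then have dN: "?d * N = ?d * (N - 1) + ?d"
    by (cases N) auto
  have "2 * ?d * N \<le> n + ?d - 1"
    unfolding N_def by simp
  then have bound: "?d * N + (?d * (N - 1) + 1) \<le> n"
    using dN n \<open>?d > 0\<close> by linarith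
  have "n + ?d - 1 < 2 * ?d * N + 2 * ?d"
    using dividend_less_div_times[of "2 * ?d" "n + ?d - 1"] \<open>?d > 0\<close> by (simp add: N_def mult.commute)
  moreover have "?d \<le> ?d * N"
    using N by simp
  ultimately have "n \<le> 4 * ?d * N"
    using \<open>?d > 0\<close> by linarith
  then have "real n \<le> 4 * real ?d * real N"
    by (metis of_nat_le_iff of_nat_mult of_nat_numeral)
  then have "1 / (4 * real ?d) * real n \<le> real N"
    using \<open>?d > 0\<close> by (simp add: field_simps)
  then have "(1 / (4 * real ?d)) ^ ?d * real n ^ ?d \<le> real N ^ ?d"
    unfolding power_mult_distrib[symmetric] by (intro power_mono) auto
  also have "\<dots> \<le> real (max_unit_simplices TYPE('d) n)"
    using grid_unit_simplices[where 'd = 'd, OF N bound] by (metis of_nat_le_iff of_nat_power)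
  finally show "(1 / (4 * real ?d)) ^ ?d * real n ^ ?d \<le> real (max_unit_simplices TYPE('d) n)" .
qed

end
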